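(* Let $w$ be a Sturmian sequence with irrational slope $x>0$ and intercept $0$. Then the sequence $\overline w$ defined by $0\,\overline w=T(0\,w)$ is a Sturmian sequence. Moreover, its slope is $R(x)$, where $$R(x)=\frac1{1-x+2\lfloor x\rfloor}.$$
   Context: A (one-sided) infinite word over $\{0,1\}$ is a Sturmian sequence if it is not ultimately periodic and, for every $n\ge1$, it has exactly $n+1$ distinct factors of length $n$; equivalently, it is aperiodic (not ultimately periodic) and balanced, i.e. for any two factors $u,v$ of the same length, $\big||u|_1-|v|_1\big|\le1$ ($|u|_s$ counts occurrences of the letter $s$ in $u$). Its slope is the limiting ratio of the number of $1$'s to the number of $0$'s in its prefixes. The Sturmian sequence with irrational slope $x>0$ and intercept $0$ is the infinite cutting sequence of the ray $\{(t,xt):t>0\}$: travelling along the ray away from the origin, one writes $0$ each time it crosses a vertical line of the integer lattice and $1$ each time it crosses a horizontal line. If $x<1$, set $k=\lfloor1/x\rfloor$; then $0w$ is an infinite concatenation of blocks $0^{k+1}1$ and $0^k1$, and $T(0w)=T_0(0w)$ is obtained by replacing each block $0^{k+1}1$ by $(01)^k1$ and each block $0^k1$ by $(01)^{k-1}1$. If $x>1$, set $k=\lfloor x\rfloor$; then $0w$ is an infinite concatenation of blocks $01^{k+1}$ and $01^k$, and $T(0w)=T_1(0w)$ is obtained by replacing each block $01^{k+1}$ by $0^k1$ and each block $01^k$ by $0^{k+1}1$. *)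

theory Defs
  imports Complex_Main "HOL-Library.Infinite_Set" "HOL-Library.Stream" "HOL-Library.Z2"
begin

text \<open>
  Infinite words over $\{0,1\}$ are values of type \<open>bit stream\<close>, finite words are values of
  type \<open>bit list\<close>. Only the fact that \<open>bit\<close> has exactly the two elements 0 and 1 matters here,
  not its field structure.
\<close>

definition factors :: "nat \<Rightarrow> bit stream \<Rightarrow> bit list set" where
  "factors n w = {stake n (sdrop i w) | i. True}"

definition ultimately_periodic :: "bit stream \<Rightarrow> bool" where
  "ultimately_periodic w \<longleftrightarrow> (\<exists>p>0. \<exists>N. \<forall>n\<ge>N. w !! (n + p) = w !! n)"

definition sturmian :: "bit stream \<Rightarrow> bool" where
  "sturmian w \<longleftrightarrow> \<not> ultimately_periodic w \<and> (\<forall>n\<ge>1. card (factors n w) = n + 1)"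

definition has_slope :: "bit stream \<Rightarrow> real \<Rightarrow> bool" where
  "has_slope w s \<longleftrightarrow>
     (\<lambda>n. real (count_list (stake n w) 1) / real (count_list (stake n w) 0)) \<longlonglongrightarrow> s"

text \<open>
  The ray \<open>{(t, x t) | t > 0}\<close> crosses a vertical lattice line at parameter \<open>t\<close> iff \<open>t\<close> is an
  integer, and a horizontal one iff \<open>x * t\<close> is an integer.
\<close>

definition crossings :: "real \<Rightarrow> real set" where
  "crossings x = {t. t > 0 \<and> (t \<in> \<int> \<or> x * t \<in> \<int>)}"

text \<open>
  \<open>\<tau>\<close> lists the crossings in the order in which they are met. For irrational \<open>x\<close> no point of the
  ray lies on lines of both kinds.
\<close>

definition cutting_sequence :: "real \<Rightarrow> bit stream \<Rightarrow> bool" where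
  "cutting_sequence x w \<longleftrightarrow>
     (\<exists>\<tau> :: nat \<Rightarrow> real. strict_mono \<tau> \<and> range \<tau> = crossings x \<and>
        (\<forall>n. (w !! n = 0 \<longleftrightarrow> \<tau> n \<in> \<int>) \<and> (w !! n = 1 \<longleftrightarrow> x * \<tau> n \<in> \<int>)))"

lemma crossings_disjoint:
  fixes x t :: real
  assumes "x \<notin> \<rat>" "t > 0" "t \<in> \<int>"
  shows "x * t \<notin> \<int>"
proof
  assume "x * t \<in> \<int>"
  then have "x * t / t \<in> \<rat>"
    using assms(3) Ints_subset_Rats by (intro Rats_divide) auto
  moreover have "x * t / t = x" using assms(2) by simp
  ultimately show False using assms(1) by simp
qed

lemma cutting_sequence_exists:
  assumes "x > 0" "x \<notin> \<rat>"
  shows "\<exists>w. cutting_sequence x w"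
proof -
  let ?S = "crossings x"
  define c where "c t = nat (\<lfloor>t\<rfloor> + \<lfloor>x * t\<rfloor>)" for t
  have less: "c s < c t" if "s \<in> ?S" "t \<in> ?S" "s < t" for s t
  proof -
    have pos: "s > 0" "x * s > 0" "x * s < x * t"
      using that assms(1) by (auto simp: crossings_def)
    have *: "\<lfloor>a\<rfloor> < \<lfloor>b\<rfloor>" if "b \<in> \<int>" "a < b" for a b :: real
      using that by (auto elim!: Ints_cases simp: floor_less_iff)
    have le: "\<lfloor>s\<rfloor> \<le> \<lfloor>t\<rfloor>" "\<lfloor>x * s\<rfloor> \<le> \<lfloor>x * t\<rfloor>"
      using that(3) pos(3) by (auto intro: floor_mono)
    have "\<lfloor>s\<rfloor> < \<lfloor>t\<rfloor> \<or> \<lfloor>x * s\<rfloor> < \<lfloor>x * t\<rfloor>"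
      using that(2,3) pos(3) * by (auto simp: crossings_def)
    moreover have "\<lfloor>s\<rfloor> \<ge> 0" "\<lfloor>x * s\<rfloor> \<ge> 0"
      using pos by auto
    ultimately show ?thesis
      using le unfolding c_def by linarith
  qed
  have inj: "inj_on c ?S"
    by (intro linorder_inj_onI) (auto dest: less)
  have "range (\<lambda>n. real (Suc n)) \<subseteq> ?S"
    by (auto simp: crossings_def)
  moreover have "infinite (range (\<lambda>n. real (Suc n)))"
    using finite_imageD[of "\<lambda>n. real (Suc n)" UNIV] by (auto simp: inj_def)
  ultimately have "infinite (c ` ?S)"
    using inj by (meson finite_imageD finite_subset)
  then obtain r :: "nat \<Rightarrow> nat" where r: "strict_mono r" "range r = c ` ?S"
    by (metis strict_mono_enumerate range_enumerate)
  define \<tau> where "\<tau> n = inv_into ?S c (r n)" for n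
  have \<tau>: "\<tau> n \<in> ?S" "c (\<tau> n) = r n" for n
    using r(2) unfolding \<tau>_def by (auto intro!: inv_into_into f_inv_into_f)
  have "strict_mono \<tau>"
  proof (rule strict_monoI)
    fix m n :: nat assume "m < n"
    then have "c (\<tau> m) < c (\<tau> n)" using r(1) by (simp add: \<tau> strict_monoD)
    then show "\<tau> m < \<tau> n" by (metis \<tau>(1) less less_irrefl less_trans linorder_cases)
  qed
  moreover have "range \<tau> = ?S"
  proof
    show "?S \<subseteq> range \<tau>"
    proof
      fix t assume t: "t \<in> ?S"
      then obtain n where "r n = c t" using r(2) by (metis imageE imageI)
      then have "\<tau> n = t" using t inj by (simp add: \<tau>_def)
      then show "t \<in> range \<tau>" by blast
    qed
  qed (use \<tau> in auto)
  moreover define w where "w = smap (\<lambda>n. if \<tau> n \<in> \<int> then 0 else 1 :: bit) (fromN 0)"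
  have "(w !! n = 0 \<longleftrightarrow> \<tau> n \<in> \<int>) \<and> (w !! n = 1 \<longleftrightarrow> x * \<tau> n \<in> \<int>)" for n
    using \<tau>(1)[of n] crossings_disjoint[OF assms(2), of "\<tau> n"]
    by (auto simp: w_def crossings_def)
  ultimately show ?thesis unfolding cutting_sequence_def by blast
qed

definition wpow :: "bit list \<Rightarrow> nat \<Rightarrow> bit list" where
  "wpow u n = concat (replicate n u)"

definition blocks0 :: "nat \<Rightarrow> bit list set" where
  "blocks0 k = {wpow [0] (k + 1) @ [1], wpow [0] k @ [1]}"

definition blocks1 :: "nat \<Rightarrow> bit list set" where
  "blocks1 k = {[0] @ wpow [1] (k + 1), [0] @ wpow [1] k}"

definition subst0 :: "nat \<Rightarrow> bit list \<Rightarrow> bit list" where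
  "subst0 k b = (if b = wpow [0] (k + 1) @ [1] then wpow [0, 1] k @ [1]
                 else wpow [0, 1] (k - 1) @ [1])"

definition subst1 :: "nat \<Rightarrow> bit list \<Rightarrow> bit list" where
  "subst1 k b = (if b = [0] @ wpow [1] (k + 1) then wpow [0] k @ [1]
                 else wpow [0] (k + 1) @ [1])"

definition block_decomposition :: "bit list set \<Rightarrow> bit stream \<Rightarrow> bit list stream \<Rightarrow> bool" where
  "block_decomposition B u bs \<longleftrightarrow> sset bs \<subseteq> B \<and> flat bs = u"

text \<open>
  Meaningful only if \<open>u\<close> has exactly one decomposition into blocks from \<open>B\<close>.
\<close>

definition replace_blocks ::
    "bit list set \<Rightarrow> (bit list \<Rightarrow> bit list) \<Rightarrow> bit stream \<Rightarrow> bit stream" where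
  "replace_blocks B h u = flat (smap h (THE bs. block_decomposition B u bs))"

definition T0 :: "nat \<Rightarrow> bit stream \<Rightarrow> bit stream" where
  "T0 k = replace_blocks (blocks0 k) (subst0 k)"

definition T1 :: "nat \<Rightarrow> bit stream \<Rightarrow> bit stream" where
  "T1 k = replace_blocks (blocks1 k) (subst1 k)"

text \<open>The parameter \<open>x\<close> is the slope of \<open>w\<close>, when the map is applied to \<open>0 ## w\<close>.\<close>

definition blocks :: "real \<Rightarrow> bit list set" where
  "blocks x = (if x < 1 then blocks0 (nat \<lfloor>1 / x\<rfloor>) else blocks1 (nat \<lfloor>x\<rfloor>))"

definition T :: "real \<Rightarrow> bit stream \<Rightarrow> bit stream" where
  "T x = (if x < 1 then T0 (nat \<lfloor>1 / x\<rfloor>) else T1 (nat \<lfloor>x\<rfloor>))"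

definition R :: "real \<Rightarrow> real" where
  "R x = 1 / (1 - x + 2 * real_of_int \<lfloor>x\<rfloor>)"

end

theory Submission
  imports Defs "HOL-Analysis.Kronecker_Approximation_Theorem"
begin

text \<open>
  With \<open>a = x / (1 + x)\<close>, the word \<open>0w\<close> is the mechanical word whose prefix of length \<open>n\<close> contains
  \<open>\<lfloor>n a\<rfloor>\<close> ones. Hence the ones sit just before the positions \<open>\<lceil>j / a\<rceil>\<close> and the zeros at the
  positions \<open>\<lfloor>j / (1 - a)\<rfloor>\<close>, which makes the blocks and their images explicit. Comparing positions,
  \<open>T(0w)\<close> is the mechanical word with \<open>1 / a' = 2 - x + 2\<lfloor>x\<rfloor>\<close>, that is, \<open>a' / (1 - a') = R x\<close>.
  A mechanical word with irrational \<open>a\<close> is Sturmian by the density of the fractional parts of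
  \<open>n a\<close>, and aperiodic because its complexity is unbounded.
\<close>

section \<open>Infinite concatenations and uniqueness of block decompositions\<close>

lemma flat_prefix:
  assumes "\<And>i. f i \<noteq> []"
  shows "flat (smap f nats) = concat (map f [0..<m]) @- flat (smap f (fromN m))"
proof (induction m)
  case (Suc m)
  have "flat (smap f (fromN m)) = f m @- flat (smap f (fromN (Suc m)))"
    using assms by (subst flat_unfold) auto
  then show ?case using Suc by simp
qed simp

lemma concat_consecutive:
  assumes "mono s" "a \<le> b"
  shows "concat (map (\<lambda>i. map h [s i..<s (Suc i)]) [a..<b]) = map h [s a..<s b]"
  using assms(2)
proof (induction rule: dec_induct)
  case (step b)
  have "s a \<le> s b" "s b \<le> s (Suc b)"
    using step assms(1) by (auto intro: monoD)
  then have "[s a..<s (Suc b)] = [s a..<s b] @ [s b..<s (Suc b)]"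
    by (metis le_Suc_ex upt_add_eq_append)
  then show ?case using step by simp
qed simp

lemma stake_conv_map: "stake n u = map (snth u) [0..<n]"
  by (induction n) (auto simp: stake_Suc simp del: stake.simps(2))

text \<open>Serves both to decompose a word and to recognise the image of its blocks: only the cut
  points \<open>s j\<close> have to be known. The first \<open>n + 1\<close> segments telescope to
  the prefix of length \<open>s (Suc n)\<close>, and strict monotonicity gives
  \<open>n < s (Suc n)\<close>, so this prefix settles the letter \<open>n\<close>. Strictness also
  makes every segment nonempty, as unfolding \<open>flat\<close> requires.\<close>

lemma flat_consecutive:
  assumes "strict_mono s" "s 0 = (0::nat)" "\<And>j. f j = map (snth u) [s j..<s (Suc j)]"
  shows "flat (smap f nats) = u"
proof -
  have f: "f = (\<lambda>j. map (snth u) [s j..<s (Suc j)])"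
    using assms(3) by auto
  have ne: "f i \<noteq> []" for i
    using strict_monoD[OF assms(1), of i "Suc i"] by (simp add: assms(3))
  have "flat (smap f nats) !! n = u !! n" for n
  proof -
    have "concat (map f [0..<Suc n]) = map (snth u) [0..<s (Suc n)]"
      using concat_consecutive[of s 0 "Suc n" "snth u"] assms(1,2)
      unfolding f by (simp only: strict_mono_mono zero_le)
    moreover have "n < s (Suc n)"
      using assms(1) by (meson Suc_le_lessD strict_mono_imp_increasing)
    ultimately show ?thesis
      by (subst flat_prefix[of f "Suc n", OF ne]) simp
  qed
  then show ?thesis
    using smap_alt[of id "flat (smap f nats)" u] by (simp add: stream.map_id)
qed

text \<open>By coinduction: once the first blocks agree, cancelling them leaves two decompositions
  of the same remaining word. Hence for a concrete block set it suffices to read off the first block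
  from the word.\<close>

lemma block_decomposition_unique:
  assumes "[] \<notin> B"
    and hd: "\<And>bs bs'. \<lbrakk>sset bs \<subseteq> B; sset bs' \<subseteq> B; flat bs = flat bs'\<rbrakk> \<Longrightarrow> shd bs = shd bs'"
    and "block_decomposition B u bs" "block_decomposition B u bs'"
  shows "bs = bs'"
proof -
  have "sset bs \<subseteq> B \<and> sset bs' \<subseteq> B \<and> flat bs = flat bs'"
    using assms by (auto simp: block_decomposition_def)
  then show ?thesis
  proof (coinduction arbitrary: bs bs')
    case (Eq_stream bs bs')
    then have eq: "shd bs = shd bs'" using hd by blast
    have "shd bs \<noteq> []" "shd bs' \<noteq> []"
      using Eq_stream assms(1) by (metis shd_sset subsetD)+
    then have "flat (stl bs) = flat (stl bs')"
      using Eq_stream eq flat_unfold[of bs] flat_unfold[of bs'] by simp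
    then show ?case using Eq_stream eq by (auto dest: stl_sset)
  qed
qed

lemma wpow_singleton: "wpow [c] n = replicate n c"
  by (induction n) (auto simp: wpow_def)

text \<open>The letter at index \<open>k\<close> reveals the first block: it is the last 0 of the
  long block, but the final 1 of the short one.\<close>

lemma blocks0_decomposition_unique:
  assumes "block_decomposition (blocks0 k) u bs" "block_decomposition (blocks0 k) u bs'"
  shows "bs = bs'"
proof (rule block_decomposition_unique[OF _ _ assms])
  show "[] \<notin> blocks0 k" by (simp add: blocks0_def)
  fix bs bs' assume *: "sset bs \<subseteq> blocks0 k" "sset bs' \<subseteq> blocks0 k" "flat bs = flat bs'"
  have nth: "flat cs !! k = 0 \<longleftrightarrow> shd cs = replicate (Suc k) 0 @ [1]"
    if "sset cs \<subseteq> blocks0 k" for cs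
  proof -
    have "shd cs \<in> blocks0 k" using that shd_sset by auto
    then show ?thesis
      by (subst flat_unfold) (auto simp: blocks0_def wpow_singleton nth_append shift_snth nth_Cons' simp del: replicate.simps)
  qed
  have "shd bs \<in> blocks0 k" "shd bs' \<in> blocks0 k" using * shd_sset by auto
  moreover have "shd bs = replicate (Suc k) 0 @ [1] \<longleftrightarrow> shd bs' = replicate (Suc k) 0 @ [1]"
    using nth[of bs] nth[of bs'] * by simp
  ultimately show "shd bs = shd bs'"
    by (auto simp: blocks0_def wpow_singleton)
qed

text \<open>The letter at index \<open>k + 1\<close> reveals the first block: it is the last 1 of
  the long block, whereas after a short block it is the first letter of the next block, which is
  always 0.\<close>

lemma blocks1_decomposition_unique:
  assumes "block_decomposition (blocks1 k) u bs" "block_decomposition (blocks1 k) u bs'"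
  shows "bs = bs'"
proof (rule block_decomposition_unique[OF _ _ assms])
  show "[] \<notin> blocks1 k" by (simp add: blocks1_def)
  fix bs bs' assume *: "sset bs \<subseteq> blocks1 k" "sset bs' \<subseteq> blocks1 k" "flat bs = flat bs'"
  have nth: "flat cs !! Suc k = 1 \<longleftrightarrow> shd cs = 0 # replicate (Suc k) 1"
    if "sset cs \<subseteq> blocks1 k" for cs
  proof -
    have "shd cs \<in> blocks1 k" "shd (stl cs) \<in> blocks1 k"
      using that shd_sset stl_sset by (metis subsetD)+
    then have "shd (flat (stl cs)) = 0" "shd cs \<in> blocks1 k"
      by (auto simp: blocks1_def)
    then show ?thesis
      by (subst flat_unfold) (auto simp: blocks1_def wpow_singleton shift_snth simp del: replicate.simps)
  qed
  have "shd bs \<in> blocks1 k" "shd bs' \<in> blocks1 k" using * shd_sset by auto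
  moreover have "shd bs = 0 # replicate (Suc k) 1 \<longleftrightarrow> shd bs' = 0 # replicate (Suc k) 1"
    using nth[of bs] nth[of bs'] * by simp
  ultimately show "shd bs = shd bs'"
    by (auto simp: blocks1_def wpow_singleton)
qed

lemma replace_blocks_eq:
  assumes "block_decomposition B u bs"
    and "\<And>bs bs'. block_decomposition B u bs \<Longrightarrow> block_decomposition B u bs' \<Longrightarrow> bs = bs'"
  shows "(\<exists>!bs. block_decomposition B u bs) \<and> replace_blocks B h u = flat (smap h bs)"
proof -
  have "(THE bs. block_decomposition B u bs) = bs"
    using assms by (intro the_equality)
  then show ?thesis using assms by (auto simp: replace_blocks_def)
qed

section \<open>Mechanical words and the positions of their letters\<close>

definition mechanical :: "real \<Rightarrow> bit stream" where
  "mechanical a = smap (\<lambda>n. if \<lfloor>real n * a\<rfloor> < \<lfloor>real (Suc n) * a\<rfloor> then 1 else 0) nats"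

lemma snth_mechanical: "mechanical a !! n = (if \<lfloor>real n * a\<rfloor> < \<lfloor>real (Suc n) * a\<rfloor> then 1 else 0)"
  by (simp add: mechanical_def)

lemma mechanical_0: "0 < a \<Longrightarrow> a < 1 \<Longrightarrow> mechanical a !! 0 = 0"
  using snth_mechanical[of a 0] by simp

text \<open>In this range \<lfloor>n a\<rfloor> has the constant value \<open>j\<close>, so the
  letter is 1 exactly when (n + 1) a reaches j + 1.\<close>

lemma mechanical_block_one:
  assumes "a > 0" "nat \<lceil>real j / a\<rceil> \<le> n" "n < nat \<lceil>real (Suc j) / a\<rceil>"
  shows "mechanical a !! n = 1 \<longleftrightarrow> Suc n = nat \<lceil>real (Suc j) / a\<rceil>"
proof -
  have "real j / a \<le> real n" "real n < real (Suc j) / a"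
    using assms(2,3) by linarith+
  then have "real j \<le> real n * a" "real n * a < real (Suc j)"
    using assms(1) by (simp_all add: field_simps)
  then have "\<lfloor>real n * a\<rfloor> = int j" by linarith
  then have "mechanical a !! n = 1 \<longleftrightarrow> real (Suc j) \<le> real (Suc n) * a"
    unfolding snth_mechanical by (simp add: less_floor_iff del: of_nat_Suc)
  also have "\<dots> \<longleftrightarrow> real (Suc j) / a \<le> real (Suc n)"
    using assms(1) by (simp add: field_simps)
  also have "\<dots> \<longleftrightarrow> Suc n = nat \<lceil>real (Suc j) / a\<rceil>"
    using assms(3) by linarith
  finally show ?thesis .
qed

text \<open>Dually, in this range \<lfloor>(n + 1) a\<rfloor> = n - j. The letter is 0 iff
  \<lfloor>n a\<rfloor> already has this value, which means n (1 - a) \<le> j and singles out the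
  first position of the range.\<close>

lemma mechanical_block_zero:
  assumes "a < 1" "a > 0" "nat \<lfloor>real j / (1 - a)\<rfloor> \<le> n" "n < nat \<lfloor>real (Suc j) / (1 - a)\<rfloor>"
  shows "mechanical a !! n = 0 \<longleftrightarrow> n = nat \<lfloor>real j / (1 - a)\<rfloor>"
proof -
  have pos: "real j / (1 - a) \<ge> 0" using assms(1) by simp
  have "real j / (1 - a) < real (Suc n)" "real (Suc n) \<le> real (Suc j) / (1 - a)"
    using assms(3,4) by linarith+
  then have "real j < real (Suc n) * (1 - a)" "real (Suc n) * (1 - a) \<le> real (Suc j)"
    using assms(1) by (simp_all add: field_simps)
  then have b: "\<lfloor>real (Suc n) * a\<rfloor> = int n - int j"
    and b': "real n - real j - 1 \<le> real n * a" "real n * a < real n - real j + 1"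
    using assms(1,2) by (simp_all add: floor_eq_iff algebra_simps, linarith+)
  have "mechanical a !! n = 0 \<longleftrightarrow> \<not> \<lfloor>real n * a\<rfloor> < int n - int j"
    unfolding snth_mechanical b by simp
  also have "\<dots> \<longleftrightarrow> real n - real j \<le> real n * a"
    by (simp add: not_less le_floor_iff)
  also have "\<dots> \<longleftrightarrow> real n \<le> real j / (1 - a)"
    using assms(1) by (simp add: field_simps)
  also have "\<dots> \<longleftrightarrow> n = nat \<lfloor>real j / (1 - a)\<rfloor>"
    using assms(3) pos by linarith
  finally show ?thesis .
qed

lemma map_snth_mechanical_one:
  assumes "a > 0" "a < 1"
  defines "s \<equiv> \<lambda>j. nat \<lceil>real j / a\<rceil>"
  shows "strict_mono s"
    and "map (snth (mechanical a)) [s j..<s (Suc j)] = replicate (s (Suc j) - s j - 1) 0 @ [1]"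
proof -
  have less: "s j < s (Suc j)" for j
  proof -
    have "1 < 1 / a" "0 \<le> real j / a" using assms(1,2) by simp_all
    then have "real j / a + 1 < real (Suc j) / a" by (simp add: add_divide_distrib)
    then show ?thesis unfolding s_def using \<open>0 \<le> real j / a\<close> by linarith
  qed
  then show "strict_mono s" by (simp add: strict_mono_Suc_iff)
  have "mechanical a !! (s j + i) = (if s j + i + 1 = s (Suc j) then 1 else 0)"
    if "s j + i < s (Suc j)" for i
    using mechanical_block_one[OF assms(1), of j "s j + i"] that unfolding s_def
    by (auto simp del: of_nat_Suc)
  then show "map (snth (mechanical a)) [s j..<s (Suc j)] = replicate (s (Suc j) - s j - 1) 0 @ [1]"
    using less[of j] by (intro nth_equalityI) (auto simp: nth_append)
qed

lemma map_snth_mechanical_zero: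
  assumes "a > 0" "a < 1"
  defines "s \<equiv> \<lambda>j. nat \<lfloor>real j / (1 - a)\<rfloor>"
  shows "strict_mono s"
    and "map (snth (mechanical a)) [s j..<s (Suc j)] = 0 # replicate (s (Suc j) - s j - 1) 1"
proof -
  have less: "s j < s (Suc j)" for j
  proof -
    have "1 < 1 / (1 - a)" "0 \<le> real j / (1 - a)" using assms(1,2) by simp_all
    then have "real j / (1 - a) + 1 < real (Suc j) / (1 - a)" by (simp add: add_divide_distrib)
    then show ?thesis unfolding s_def using \<open>0 \<le> real j / (1 - a)\<close> by linarith
  qed
  then show "strict_mono s" by (simp add: strict_mono_Suc_iff)
  have "mechanical a !! (s j + i) = (if i = 0 then 0 else 1)"
    if "s j + i < s (Suc j)" for i
    using mechanical_block_zero[OF assms(2,1), of j "s j + i"] that unfolding s_def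
    by (auto simp del: of_nat_Suc)
  then show "map (snth (mechanical a)) [s j..<s (Suc j)] = 0 # replicate (s (Suc j) - s j - 1) 1"
    using less[of j] by (intro nth_equalityI) (auto simp: nth_Cons')
qed

section \<open>Letter counts and slope\<close>

lemma count_list_bit: "count_list xs 0 + count_list xs (1::bit) = length xs"
  by (induction xs) auto

lemma count_mechanical:
  assumes "0 < a" "a < 1"
  shows "int (count_list (stake n (mechanical a)) 1) = \<lfloor>real n * a\<rfloor>"
proof (induction n)
  case (Suc n)
  have "\<lfloor>real (Suc n) * a\<rfloor> = \<lfloor>real n * a\<rfloor> \<or> \<lfloor>real (Suc n) * a\<rfloor> = \<lfloor>real n * a\<rfloor> + 1"
    using assms by (simp add: algebra_simps) linarith
  then show ?case using Suc
    by (auto simp: stake_Suc snth_mechanical simp del: stake.simps(2) of_nat_Suc)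
qed simp

lemma has_slope_mechanical:
  assumes "0 < a" "a < 1"
  shows "has_slope (stl (mechanical a)) (a / (1 - a))"
proof -
  \<comment> \<open>The argument is \<open>Suc n\<close> because \<open>stl\<close> drops a leading
    0, which contributes no 1 to the count but shifts the length by one.\<close>
  let ?c = "\<lambda>n. real_of_int \<lfloor>real (Suc n) * a\<rfloor>"
  have c1: "real (count_list (stake n (stl (mechanical a))) 1) = ?c n" for n
  proof -
    have "stake (Suc n) (mechanical a) = 0 # stake n (stl (mechanical a))"
      using mechanical_0[OF assms] by simp
    then have "int (count_list (stake n (stl (mechanical a))) 1) = \<lfloor>real (Suc n) * a\<rfloor>"
      using count_mechanical[OF assms, of "Suc n"] by simp
    then show ?thesis by (metis of_int_of_nat_eq)
  qed
  have c0: "real (count_list (stake n (stl (mechanical a))) 0) = real n - ?c n" for n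
    using count_list_bit[of "stake n (stl (mechanical a))"] c1[of n] by (simp flip: of_nat_add)
  have lim: "(\<lambda>n. ?c n / real n) \<longlonglongrightarrow> a"
  proof (rule tendsto_sandwich)
    show "(\<lambda>n. a - 1 / real n) \<longlonglongrightarrow> a" "(\<lambda>n. a + a / real n) \<longlonglongrightarrow> a"
      by (auto intro!: tendsto_eq_intros lim_const_over_n)
    show "\<forall>\<^sub>F n in sequentially. a - 1 / real n \<le> ?c n / real n"
      using eventually_gt_at_top[of 0]
    proof (eventually_elim)
      fix n :: nat assume n: "n > 0"
      have "real n * a - 1 \<le> ?c n" using assms by (simp add: algebra_simps) linarith
      then have "(real n * a - 1) / real n \<le> ?c n / real n" by (rule divide_right_mono) simp
      then show "a - 1 / real n \<le> ?c n / real n" using n by (simp add: diff_divide_distrib)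
    qed
    show "\<forall>\<^sub>F n in sequentially. ?c n / real n \<le> a + a / real n"
      using eventually_gt_at_top[of 0]
    proof (eventually_elim)
      fix n :: nat assume n: "n > 0"
      have "?c n \<le> real n * a + a" by (simp add: algebra_simps)
      then have "?c n / real n \<le> (real n * a + a) / real n" by (rule divide_right_mono) simp
      then show "?c n / real n \<le> a + a / real n" using n by (simp add: add_divide_distrib)
    qed
  qed
  have "(\<lambda>n. (?c n / real n) / (1 - ?c n / real n)) \<longlonglongrightarrow> a / (1 - a)"
    using assms by (intro tendsto_divide tendsto_diff tendsto_const lim) auto
  moreover have "\<forall>\<^sub>F n in sequentially. (?c n / real n) / (1 - ?c n / real n) = ?c n / (real n - ?c n)"
    using eventually_gt_at_top[of 0]
    by eventually_elim (simp add: field_simps)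
  ultimately show ?thesis
    unfolding has_slope_def c0 c1 by (rule Lim_transform_eventually)
qed

section \<open>Factor complexity and aperiodicity\<close>

text \<open>A starting position \<open>i \<ge> N + p\<close> can be moved back by \<open>p\<close>
  without changing the factor, so the \<open>N + p\<close> first positions give all factors of every
  length.\<close>

lemma ultimately_periodic_factors:
  assumes "ultimately_periodic w"
  obtains K where "\<And>n. card (factors n w) \<le> K"
proof -
  obtain p N where p: "p > 0" "\<And>n. n \<ge> N \<Longrightarrow> w !! (n + p) = w !! n"
    using assms unfolding ultimately_periodic_def by blast
  have "factors n w \<subseteq> (\<lambda>i. stake n (sdrop i w)) ` {..<N + p}" for n
  proof -
    have "stake n (sdrop i w) \<in> (\<lambda>i. stake n (sdrop i w)) ` {..<N + p}" for i
    proof (induction i rule: less_induct)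
      case (less i)
      show ?case
      proof (cases "i < N + p")
        case False
        have "w !! (i + j) = w !! (i - p + j)" for j
          using p(2)[of "i - p + j"] False by (simp add: algebra_simps)
        then have "stake n (sdrop i w) = stake n (sdrop (i - p) w)"
          by (simp add: stake_conv_map sdrop_snth cong: map_cong)
        then show ?thesis using less[of "i - p"] False p(1) by simp
      qed auto
    qed
    then show ?thesis by (auto simp: factors_def)
  qed
  then have "card (factors n w) \<le> N + p" for n
    by (metis (no_types, lifting) surj_card_le card_lessThan finite_lessThan)
  then show ?thesis using that by blast
qed

text \<open>Both images are in bijection with the set of pairs \<open>(f x, g x)\<close>. This
  allows factors to be counted through a numerical invariant that distinguishes them equally
  well.\<close>

lemma card_image_eq_iff:
  assumes "\<And>x y. x \<in> A \<Longrightarrow> y \<in> A \<Longrightarrow> f x = f y \<longleftrightarrow> g x = g y"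
  shows "card (f ` A) = card (g ` A)"
proof -
  let ?P = "(\<lambda>x. (f x, g x)) ` A"
  have "card (fst ` ?P) = card ?P" "card (snd ` ?P) = card ?P"
    using assms by (auto intro!: card_image inj_onI)
  then show ?thesis by (simp add: image_image)
qed

text \<open>Provides an open interval, which a dense set must meet, for every possible count.
  Induction on the largest point \<open>b\<close>: if all points are to be counted, take the
  interval from \<open>b\<close> to \<open>u\<close>; otherwise the interval obtained for the other
  points lies below \<open>b\<close>.\<close>

lemma interval_with_card_below:
  fixes P :: "real set"
  assumes "finite P" "P \<subseteq> {0<..<u}" "m \<le> card P" "u > 0"
  shows "\<exists>c d. 0 \<le> c \<and> c < d \<and> d \<le> u \<and> (\<forall>t. c < t \<and> t < d \<longrightarrow> card {p \<in> P. p \<le> t} = m)"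
  using assms
proof (induction arbitrary: u rule: finite_linorder_max_induct)
  case empty
  then show ?case by (intro exI[of _ 0] exI[of _ u]) auto
next
  case (insert b P)
  have b: "0 < b" "b < u" using insert by auto
  show ?case
  proof (cases "m = Suc (card P)")
    case True
    have "card {p \<in> insert b P. p \<le> t} = m" if "b < t" for t
    proof -
      have "{p \<in> insert b P. p \<le> t} = insert b P" using that insert(2) by force
      then show ?thesis using True insert(1,2) by auto
    qed
    then show ?thesis using b by (intro exI[of _ b] exI[of _ u]) auto
  next
    case False
    then have "m \<le> card P" "P \<subseteq> {0<..<b}"
      using insert by auto
    then obtain c d where cd: "0 \<le> c" "c < d" "d \<le> b"
      and c: "\<And>t. c < t \<Longrightarrow> t < d \<Longrightarrow> card {p \<in> P. p \<le> t} = m"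
      using insert(3)[of b] b by blast
    have "{p \<in> insert b P. p \<le> t} = {p \<in> P. p \<le> t}" if "t < d" for t
      using that cd by auto
    then show ?thesis using cd c b by (intro exI[of _ c] exI[of _ d]) auto
  qed
qed

lemma irrational_mult_not_int:
  fixes a :: real
  assumes "a \<notin> \<rat>" "j \<noteq> (0::int)"
  shows "of_int j * a \<notin> \<int>"
proof
  assume "of_int j * a \<in> \<int>"
  then have "of_int j * a / of_int j \<in> \<rat>"
    using Ints_subset_Rats by (intro Rats_divide) auto
  then show False using assms by simp
qed

text \<open>
  Writing \<open>\<theta> = frac (i * a)\<close>, the factor of length \<open>n\<close> at position \<open>i\<close> of \<open>mechanical a\<close> is determined by the set of
  \<open>j \<le> n\<close> with \<open>\<theta> + frac (j * a) \<ge> 1\<close>. For varying \<open>\<theta>\<close> these sets form a chain, so each one is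
  determined by its cardinality, and density of the values \<open>\<theta>\<close> makes all of \<open>0, \<dots>, n\<close> occur.
\<close>

lemma card_factors_mechanical:
  assumes "0 < a" "a < 1" "a \<notin> \<rat>"
  shows "card (factors n (stl (mechanical a))) = n + 1"
proof -
  define \<Theta> where "\<Theta> = range (\<lambda>i. frac (real (Suc i) * a))"
  \<comment> \<open>The value 1 - frac (j a) is the threshold from which on \<open>t\<close>
    produces a carry in \<lfloor>t + j a\<rfloor>. The index \<open>j = 0\<close> is left out, since
    its threshold 1 is never reached.\<close>
  define P where "P = (\<lambda>j. 1 - frac (real j * a)) ` {1..n}"
  define W :: "real \<Rightarrow> bit list" where
    "W = (\<lambda>t. map (\<lambda>j. if \<lfloor>t + real j * a\<rfloor> < \<lfloor>t + real (Suc j) * a\<rfloor> then 1 else 0) [0..<n])"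
  define M where "M = (\<lambda>t. card {p \<in> P. p \<le> t})"
  have \<Theta>: "0 \<le> t" "t < 1" if "t \<in> \<Theta>" for t
    using that by (auto simp: \<Theta>_def frac_lt_1)
  have "stake n (sdrop i (stl (mechanical a))) = W (frac (real (Suc i) * a))" for i
  proof -
    \<comment> \<open>Splitting off the integer \<lfloor>(i + 1) a\<rfloor> shows that the factor
      depends on the position only through the fractional part.\<close>
    have fl: "\<lfloor>real (Suc i + k) * a\<rfloor> = \<lfloor>real (Suc i) * a\<rfloor> + \<lfloor>frac (real (Suc i) * a) + real k * a\<rfloor>" for k
      by (simp add: frac_def algebra_simps flip: of_int_add floor_add_int)
    have "mechanical a !! (Suc i + j) =
       (if \<lfloor>frac (real (Suc i) * a) + real j * a\<rfloor> < \<lfloor>frac (real (Suc i) * a) + real (Suc j) * a\<rfloor>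
        then 1 else 0)" for j
      unfolding snth_mechanical using fl[of j] fl[of "Suc j"] by (simp del: of_nat_Suc of_nat_add)
    then show ?thesis
      by (simp add: stake_conv_map sdrop_snth W_def flip: snth.simps(2) del: of_nat_Suc)
  qed
  then have "factors n (stl (mechanical a)) = W ` \<Theta>"
    by (auto simp: factors_def \<Theta>_def)
  moreover have "card (W ` \<Theta>) = card (M ` \<Theta>)"
  proof (rule card_image_eq_iff)
    fix t u assume tu: "t \<in> \<Theta>" "u \<in> \<Theta>"
    let ?F = "\<forall>j\<le>n. \<lfloor>t + real j * a\<rfloor> = \<lfloor>u + real j * a\<rfloor>"
    have fl: "\<lfloor>t + real j * a\<rfloor> = \<lfloor>real j * a\<rfloor> + of_bool (1 - frac (real j * a) \<le> t)"
      if "t \<in> \<Theta>" for t j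
    proof -
      have "0 \<le> t" "t < 1" "0 \<le> frac (real j * a)" "frac (real j * a) < 1"
        using \<Theta>[OF that] by (auto simp: frac_lt_1)
      then show ?thesis unfolding frac_def by (auto simp: of_bool_def floor_eq_iff; linarith)
    qed
    \<comment> \<open>The letters record the increments of \<lfloor>t + j a\<rfloor>, which are 0 or
      1 as 0 < a < 1. Since the initial value \<lfloor>t\<rfloor> is 0 for every
      \<open>t \<in> \<Theta>\<close>, the letters recover all these floors.\<close>
    have "W t = W u \<longleftrightarrow> ?F"
    proof
      assume W: "W t = W u"
      have "\<lfloor>t + real j * a\<rfloor> = \<lfloor>u + real j * a\<rfloor>" if "j \<le> n" for j
        using that
      proof (induction j)
        case 0
        have "\<lfloor>t\<rfloor> = 0" "\<lfloor>u\<rfloor> = 0" using \<Theta> tu by (auto simp: floor_eq_iff)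
        then show ?case by simp
      next
        case (Suc j)
        have step: "\<lfloor>t + real (Suc j) * a\<rfloor> = \<lfloor>t + real j * a\<rfloor> \<or>
          \<lfloor>t + real (Suc j) * a\<rfloor> = \<lfloor>t + real j * a\<rfloor> + 1" for t
          using assms by (simp add: algebra_simps) linarith
        have "W t ! j = W u ! j" using W by simp
        then show ?case
          using Suc step[of t] step[of u] by (auto simp: W_def simp del: of_nat_Suc split: if_splits)
      qed
      then show ?F by blast
    next
      assume ?F
      then show "W t = W u" unfolding W_def by (intro map_cong) (auto simp del: of_nat_Suc)
    qed
    also have "?F \<longleftrightarrow> {p \<in> P. p \<le> t} = {p \<in> P. p \<le> u}"
    proof -
      have "?F \<longleftrightarrow> (\<forall>j\<in>{1..n}. 1 - frac (real j * a) \<le> t \<longleftrightarrow> 1 - frac (real j * a) \<le> u)"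
      proof -
        have "\<not> 1 - frac (real 0 * a) \<le> t" "\<not> 1 - frac (real 0 * a) \<le> u"
          using \<Theta>[of t] \<Theta>[of u] tu by auto
        then show ?thesis
          unfolding fl[OF tu(1)] fl[OF tu(2)]
          by (auto simp: of_bool_def Suc_le_eq split: if_splits)
      qed
      also have "\<dots> \<longleftrightarrow> {p \<in> P. p \<le> t} = {p \<in> P. p \<le> u}"
        unfolding P_def by blast
      finally show ?thesis .
    qed
    also have "\<dots> \<longleftrightarrow> M t = M u"
    proof
      assume M: "M t = M u"
      have fin: "finite {p \<in> P. p \<le> t}" for t by (simp add: P_def)
      have "{p \<in> P. p \<le> t} \<subseteq> {p \<in> P. p \<le> u} \<or> {p \<in> P. p \<le> u} \<subseteq> {p \<in> P. p \<le> t}"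
        by auto
      then show "{p \<in> P. p \<le> t} = {p \<in> P. p \<le> u}"
        using card_subset_eq[OF fin, of "{p \<in> P. p \<le> t}" u] card_subset_eq[OF fin, of "{p \<in> P. p \<le> u}" t]
          M[unfolded M_def] by argo
    next
      assume "{p \<in> P. p \<le> t} = {p \<in> P. p \<le> u}"
      then show "M t = M u" unfolding M_def by (rule arg_cong)
    qed
    finally show "W t = W u \<longleftrightarrow> M t = M u" .
  qed
  moreover have "M ` \<Theta> = {0..n}"
  proof -
    have fr: "frac (real j * a) > 0" if "j \<ge> 1" for j
      using irrational_mult_not_int[OF assms(3), of "int j"] that by (simp add: frac_gt_0_iff)
    \<comment> \<open>Two equal thresholds would make (i - j) a an integer, so irrationality yields
      exactly \<open>n\<close> thresholds.\<close>
    have "inj_on (\<lambda>j. 1 - frac (real j * a)) {1..n}"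
    proof (rule inj_onI)
      fix i j assume "1 - frac (real i * a) = 1 - frac (real j * a)"
      then have "real_of_int (int i - int j) * a = of_int (\<lfloor>real i * a\<rfloor> - \<lfloor>real j * a\<rfloor>)"
        by (simp add: frac_def algebra_simps)
      then have "of_int (int i - int j) * a \<in> \<int>" by (metis Ints_of_int)
      then show "i = j" using irrational_mult_not_int[OF assms(3), of "int i - int j"] by force
    qed
    then have P: "card P = n" "finite P" "P \<subseteq> {0<..<1}"
      using fr by (auto simp: P_def card_image frac_lt_1)
    have "m \<in> M ` \<Theta>" if m: "m \<le> n" for m
    proof -
      obtain c d where cd: "0 \<le> c" "c < d" "d \<le> 1"
        and c: "\<And>t. c < t \<Longrightarrow> t < d \<Longrightarrow> card {p \<in> P. p \<le> t} = m"
        using interval_with_card_below[OF P(2,3), of m] m P(1) by auto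
      \<comment> \<open>Approximating the midpoint to within half the length places the fractional
        part strictly between \<open>c\<close> and \<open>d\<close>. Positivity of \<open>k\<close>
        is needed because \<open>\<Theta>\<close> starts with the multiple 1 of
        \<open>a\<close>.\<close>
      obtain k where k: "k > 0" "\<bar>frac (real k * a) - (c + d) / 2\<bar> < (d - c) / 2"
        using Kronecker_approx_1_explicit[OF assms(3), of "(c + d) / 2" "(d - c) / 2"] cd by auto
      have "M (frac (real k * a)) = m"
        unfolding M_def using k by (intro c) (auto simp: abs_less_iff field_simps)
      moreover have "frac (real (Suc (k - 1)) * a) \<in> \<Theta>"
        unfolding \<Theta>_def by (rule rangeI)
      then have "frac (real k * a) \<in> \<Theta>"
        using k(1) by simp
      ultimately show ?thesis by blast
    qed
    moreover have "M t \<le> n" for t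
      unfolding M_def using P card_mono[of P "{p \<in> P. p \<le> t}"] by auto
    ultimately show ?thesis by auto
  qed
  ultimately show ?thesis by simp
qed

lemma sturmian_mechanical:
  assumes "0 < a" "a < 1" "a \<notin> \<rat>"
  shows "sturmian (stl (mechanical a))"
  unfolding sturmian_def
proof (intro conjI notI allI impI card_factors_mechanical[OF assms])
  assume "ultimately_periodic (stl (mechanical a))"
  then obtain K where "\<And>n. card (factors n (stl (mechanical a))) \<le> K"
    by (rule ultimately_periodic_factors) blast
  from this[of K] show False by (simp add: card_factors_mechanical[OF assms])
qed

section \<open>Cutting sequences as mechanical words\<close>

text \<open>Both sides count the crossings up to \<tau> n: there are \<lfloor>\<tau> n\<rfloor>
  vertical ones, at the integers, and \<lfloor>x \<tau> n\<rfloor> horizontal ones, at the multiples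
  of 1 / x. No crossing is counted twice because \<open>x\<close> is irrational.\<close>

lemma cutting_sequence_index:
  assumes x: "x > 0" "x \<notin> \<rat>" and \<tau>: "strict_mono \<tau>" "range \<tau> = crossings x"
  shows "int (Suc n) = \<lfloor>\<tau> n\<rfloor> + \<lfloor>x * \<tau> n\<rfloor>"
proof -
  let ?T = "\<tau> n"
  let ?V = "real ` {1..nat \<lfloor>?T\<rfloor>}" and ?H = "(\<lambda>i. real i / x) ` {1..nat \<lfloor>x * ?T\<rfloor>}"
  have pos: "?T > 0" using \<tau>(2) unfolding crossings_def by blast
  have "\<tau> ` {..n} = {t \<in> crossings x. t \<le> ?T}"
    using \<tau>(1) unfolding \<tau>(2)[symmetric] by (auto simp: strict_mono_less_eq)
  also have "\<dots> = ?V \<union> ?H"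
  proof (intro equalityI subsetI)
    fix t assume t: "t \<in> {t \<in> crossings x. t \<le> ?T}"
    then have "t > 0" "t \<le> ?T" "x * t > 0" "x * t \<le> x * ?T" and "t \<in> \<int> \<or> x * t \<in> \<int>"
      using x by (auto simp: crossings_def)
    from this(5) show "t \<in> ?V \<union> ?H"
    proof
      assume "t \<in> \<int>"
      then obtain i where i: "t = of_int i" by (elim Ints_cases)
      then have "t = real (nat i)" "nat i \<in> {1..nat \<lfloor>?T\<rfloor>}"
        using \<open>t > 0\<close> \<open>t \<le> ?T\<close> by (auto simp: le_floor_iff nat_mono le_nat_iff)
      then show ?thesis by blast
    next
      assume "x * t \<in> \<int>"
      then obtain i where i: "x * t = of_int i" by (elim Ints_cases)
      then have "i > 0" using \<open>x * t > 0\<close> by simp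
      then have "t = real (nat i) / x" "nat i \<in> {1..nat \<lfloor>x * ?T\<rfloor>}"
        using i x \<open>x * t \<le> x * ?T\<close> by (auto simp: le_floor_iff le_nat_iff field_simps)
      then show ?thesis by blast
    qed
  next
    fix t assume "t \<in> ?V \<union> ?H"
    then show "t \<in> {t \<in> crossings x. t \<le> ?T}"
    proof
      assume "t \<in> ?V"
      then obtain i where "t = real i" "1 \<le> i" "int i \<le> \<lfloor>?T\<rfloor>" by auto
      then show ?thesis by (auto simp: crossings_def le_floor_iff)
    next
      assume "t \<in> ?H"
      then obtain i where "t = real i / x" "1 \<le> i" "int i \<le> \<lfloor>x * ?T\<rfloor>" using x(1) by auto
      then have "t > 0" "x * t = real i" and le: "x * t \<le> x * ?T"
        using x by (auto simp: le_floor_iff)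
      moreover have "t \<le> ?T" using le x(1) by (simp only: mult_le_cancel_left_pos)
      ultimately show ?thesis by (auto simp: crossings_def)
    qed
  qed
  finally have "card (\<tau> ` {..n}) = card (?V \<union> ?H)" by simp
  moreover have "card (\<tau> ` {..n}) = Suc n"
    using \<tau>(1) by (simp add: card_image strict_mono_imp_inj_on inj_on_subset)
  moreover have "card ?V = nat \<lfloor>?T\<rfloor>" "card ?H = nat \<lfloor>x * ?T\<rfloor>"
    using x by (auto simp: card_image inj_on_def)
  moreover have "?V \<inter> ?H = {}"
  proof -
    have "x * t \<in> \<int>" if "t \<in> ?H" for t using that x by auto
    moreover have "t \<in> \<int> \<and> t > 0" if "t \<in> ?V" for t using that by auto
    ultimately show ?thesis using crossings_disjoint[OF x(2)] by blast
  qed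
  ultimately have "Suc n = nat \<lfloor>?T\<rfloor> + nat \<lfloor>x * ?T\<rfloor>"
    by (simp add: card_Un_disjoint)
  moreover have "\<lfloor>?T\<rfloor> \<ge> 0" "\<lfloor>x * ?T\<rfloor> \<ge> 0" using pos x by auto
  ultimately show ?thesis by linarith
qed

lemma cutting_sequence_eq_mechanical:
  assumes x: "x > 0" "x \<notin> \<rat>" and "cutting_sequence x w"
  shows "0 ## w = mechanical (x / (1 + x))"
proof -
  let ?a = "x / (1 + x)"
  obtain \<tau> where \<tau>: "strict_mono \<tau>" "range \<tau> = crossings x"
    and w: "\<And>n. w !! n = 0 \<longleftrightarrow> \<tau> n \<in> \<int>" "\<And>n. w !! n = 1 \<longleftrightarrow> x * \<tau> n \<in> \<int>"
    using assms(3) unfolding cutting_sequence_def by blast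
  have step: "w !! n = mechanical ?a !! Suc n" for n
  proof (cases "w !! n = 0")
    case True
    then obtain i where i: "\<tau> n = of_int i" using w(1) Ints_cases by blast
    define m where "m = \<lfloor>x * of_int i\<rfloor>"
    have m: "of_int m \<le> x * of_int i" "x * of_int i < of_int m + 1"
      unfolding m_def by linarith+
    have "real_of_int (int (Suc n)) = real_of_int (i + m)"
      using cutting_sequence_index[OF x \<tau>, of n] i by (simp only: m_def floor_of_int)
    then have n: "real (Suc n) = of_int i + of_int m" by simp
    \<comment> \<open>After multiplication by 1 + x these are the bounds in \<open>m\<close>: (i +
      m) x / (1 + x) \<ge> m says x i \<ge> m, and (i + m + 1) x / (1 + x) < m + 1 says x i < m +
      1.\<close>
    have "of_int m \<le> real (Suc n) * ?a" "real (Suc (Suc n)) * ?a < of_int m + 1"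
      using m n x(1) by (simp_all add: field_simps)
    then have "m \<le> \<lfloor>real (Suc n) * ?a\<rfloor>" "\<lfloor>real (Suc (Suc n)) * ?a\<rfloor> < m + 1"
      by (simp_all only: le_floor_iff floor_less_iff of_int_add of_int_1)
    then have "\<not> \<lfloor>real (Suc n) * ?a\<rfloor> < \<lfloor>real (Suc (Suc n)) * ?a\<rfloor>"
      by linarith
    then show ?thesis using True by (simp add: snth_mechanical del: snth.simps of_nat_Suc)
  next
    case False
    then have "x * \<tau> n \<in> \<int>" and \<tau>n: "\<tau> n \<notin> \<int>" using w[of n] by simp_all
    then obtain j where j: "x * \<tau> n = of_int j" using Ints_cases by blast
    define m where "m = \<lfloor>\<tau> n\<rfloor>"
    have "of_int m \<noteq> \<tau> n" using \<tau>n by (metis Ints_of_int)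
    then have m: "of_int m < \<tau> n" "\<tau> n < of_int m + 1"
      unfolding m_def by linarith+
    then have "x * of_int m < of_int j" "of_int j < x * (of_int m + 1)"
      using x(1) by (simp_all flip: j)
    moreover have "real_of_int (int (Suc n)) = real_of_int (m + j)"
      using cutting_sequence_index[OF x \<tau>, of n] j by (simp only: m_def floor_of_int)
    then have "real (Suc n) = of_int m + of_int j" by simp
    \<comment> \<open>Likewise (m + j) x / (1 + x) < j says x m < j, and the second inequality says
      j \<le> x (m + 1): the ray meets height \<open>j\<close> between the vertical lines
      \<open>m\<close> and \<open>m + 1\<close>.\<close>
    ultimately have "real (Suc n) * ?a < of_int j" "of_int j \<le> real (Suc (Suc n)) * ?a"
      using x(1) by (simp_all add: field_simps)
    then have "\<lfloor>real (Suc n) * ?a\<rfloor> < j" "j \<le> \<lfloor>real (Suc (Suc n)) * ?a\<rfloor>"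
      by (simp_all only: le_floor_iff floor_less_iff)
    then have "\<lfloor>real (Suc n) * ?a\<rfloor> < \<lfloor>real (Suc (Suc n)) * ?a\<rfloor>"
      by linarith
    then show ?thesis using False by (simp add: snth_mechanical del: snth.simps of_nat_Suc)
  qed
  have "(0 ## w) !! n = mechanical ?a !! n" for n
  proof (cases n)
    case 0
    then show ?thesis using mechanical_0[of ?a] x(1) by simp
  qed (use step in simp)
  then show ?thesis
    using smap_alt[of id "0 ## w" "mechanical ?a"] by (simp add: stream.map_id)
qed

section \<open>Action of \<open>T\<close> on mechanical words\<close>

lemma ceiling_of_int_diff: "\<lceil>of_int m - y\<rceil> = m - \<lfloor>y::real\<rfloor>"
  by (simp add: ceiling_def)

text \<open>For a = x / (1 + x) one has 1 / a = 1 + 1 / x, so the cuts after the ones lie at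
  \<lceil>j / a\<rceil> = j + Z j. Block number \<open>j\<close> therefore has
  \<open>Z (Suc j) - Z j\<close> zeros, and this difference is \<open>k\<close> or
  \<open>k + 1\<close>.\<close>

lemma blocks0_mechanical:
  assumes x: "0 < x" "x < 1"
  defines "k \<equiv> nat \<lfloor>1 / x\<rfloor>" and "Z \<equiv> \<lambda>j. nat \<lceil>real j / x\<rceil>"
  defines "bs \<equiv> smap (\<lambda>j. replicate (Z (Suc j) - Z j) 0 @ [1]) nats"
  shows "block_decomposition (blocks0 k) (mechanical (x / (1 + x))) bs"
    and "flat (smap (subst0 k) bs) = mechanical (1 / (2 - x))"
proof -
  have k: "1 \<le> k" "real k \<le> 1 / x" "1 / x < real k + 1"
    using x unfolding k_def by (auto simp: le_nat_iff le_floor_iff)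
  have Z: "real j / x \<le> real (Z j)" "real (Z j) < real j / x + 1" for j
  proof -
    have "0 \<le> real j / x" using x by simp
    then show "real j / x \<le> real (Z j)" "real (Z j) < real j / x + 1"
      unfolding Z_def by linarith+
  qed
  have d: "Z (Suc j) = Z j + k \<or> Z (Suc j) = Z j + Suc k" for j
  proof -
    have "real (Suc j) / x = real j / x + 1 / x" by (simp add: add_divide_distrib)
    then have "real (Z (Suc j)) < real (Z j + Suc k) + 1" "real (Z j + k) < real (Z (Suc j)) + 1"
      using Z[of j] Z[of "Suc j"] k by simp_all
    then show ?thesis by linarith
  qed
  have Z_mono: "strict_mono Z"
    unfolding strict_mono_Suc_iff
  proof
    show "Z j < Z (Suc j)" for j using d[of j] k(1) by auto
  qed
  show "block_decomposition (blocks0 k) (mechanical (x / (1 + x))) bs"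
    unfolding block_decomposition_def
  proof
    show "sset bs \<subseteq> blocks0 k"
    proof -
      have "replicate (Z (Suc j) - Z j) 0 @ [1] \<in> blocks0 k" for j
        using d[of j] by (auto simp: blocks0_def wpow_singleton)
      then show ?thesis by (auto simp: bs_def stream.set_map)
    qed
    let ?s = "\<lambda>j. nat \<lceil>real j / (x / (1 + x))\<rceil>"
    have s: "?s j = j + Z j" for j
    proof -
      have "real j / (x / (1 + x)) = real j / x + of_int (int j)" using x by (simp add: field_simps)
      then have "\<lceil>real j / (x / (1 + x))\<rceil> = \<lceil>real j / x\<rceil> + int j" by (simp only: ceiling_add_of_int)
      moreover have "0 \<le> real j / x" using x by simp
      ultimately show ?thesis unfolding Z_def by linarith
    qed
    have a: "0 < x / (1 + x)" "x / (1 + x) < 1" using x by auto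
    show "flat bs = mechanical (x / (1 + x))"
      unfolding bs_def
    proof (rule flat_consecutive[of ?s])
      show "replicate (Z (Suc j) - Z j) 0 @ [1] = map (snth (mechanical (x / (1 + x)))) [?s j..<?s (Suc j)]" for j
        unfolding map_snth_mechanical_one(2)[OF a] unfolding s by simp
    qed (use map_snth_mechanical_one(1)[OF a] in auto)
  qed
  \<comment> \<open>Cut \<open>mechanical ?b\<close> after each 1: the piece number \<open>i\<close> is \<open>1\<close> if \<open>i + 1\<close> is one of the \<open>Z j\<close> and \<open>01\<close>
    otherwise, so the pieces from \<open>Z j\<close> up to \<open>Z (j + 1)\<close> make up the image of the block number \<open>j\<close>.\<close>
  let ?b = "1 / (2 - x)"
  have b: "0 < ?b" "?b < 1" using x by auto
  define s where "s j = nat \<lceil>real j / ?b\<rceil>" for j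
  \<comment> \<open>Since 1 / b = 2 - x, piece number \<open>i\<close> has length 2 minus the
    increment of \<lfloor>i x\<rfloor>.\<close>
  have s: "int (s j) = 2 * int j - \<lfloor>real j * x\<rfloor>" for j
  proof -
    have "real j / ?b = of_int (2 * int j) - real j * x" by (simp add: algebra_simps)
    then have "\<lceil>real j / ?b\<rceil> = 2 * int j - \<lfloor>real j * x\<rfloor>"
      by (simp only: ceiling_of_int_diff)
    moreover have "0 \<le> real j / ?b" using b by simp
    ultimately show ?thesis unfolding s_def by linarith
  qed
  have fl: "\<lfloor>real i * x\<rfloor> = int j" if "Z j \<le> i" "i < Z (Suc j)" for i j
  proof -
    have "real j / x \<le> real i" "real i < real (Suc j) / x"
      using that unfolding Z_def by linarith+
    then show ?thesis using x by (simp add: floor_eq_iff field_simps)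
  qed
  show "flat (smap (subst0 k) bs) = mechanical ?b"
    unfolding bs_def stream.map_comp
  proof (rule flat_consecutive)
    show "strict_mono (\<lambda>j. s (Z j))"
      using map_snth_mechanical_one(1)[OF b] Z_mono unfolding s_def strict_mono_def by blast
    show "s (Z 0) = 0" by (simp add: s_def Z_def)
    fix j
    \<comment> \<open>One less than the number of zeros in the block, as the last piece of the group
      is the single letter 1. The two possible values \<open>k\<close> and \<open>k - 1\<close> are
      the exponents in \<open>subst0\<close>.\<close>
    define d where "d = Z (Suc j) - Z j - 1"
    have Zd: "Z (Suc j) = Suc (Z j + d)" using d[of j] k(1) by (auto simp: d_def)
    let ?g = "\<lambda>i. map (snth (mechanical ?b)) [s i..<s (Suc i)]"
    have g: "?g i = replicate (s (Suc i) - s i - 1) 0 @ [1]" for i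
      unfolding s_def by (rule map_snth_mechanical_one(2)[OF b])
    have "?g i = [0, 1]" if "i \<in> set [Z j..<Z j + d]" for i
    proof -
      have "int (s (Suc i)) - int (s i) = 2"
        using that Zd unfolding s by (subst (1 2) fl[where j = j]) auto
      then have "s (Suc i) - s i - 1 = 1" by linarith
      then show ?thesis by (simp add: g)
    qed
    then have "map ?g [Z j..<Z j + d] = map (\<lambda>_. [0, 1]) [Z j..<Z j + d]"
      by (intro map_cong) auto
    then have "map ?g [Z j..<Z j + d] = replicate d [0, 1]"
      by (simp add: map_replicate_const)
    moreover have "?g (Z j + d) = [1]"
    proof -
      have "\<lfloor>real (Z (Suc j)) * x\<rfloor> = int (Suc j)"
        using Z_mono by (intro fl) (auto simp: strict_mono_less)
      then have "int (s (Suc (Z j + d))) - int (s (Z j + d)) = 1"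
        using Zd fl[of j "Z j + d"] unfolding s by simp
      then have "s (Suc (Z j + d)) - s (Z j + d) - 1 = 0" by linarith
      then show ?thesis by (simp add: g)
    qed
    ultimately have "concat (map ?g [Z j..<Z (Suc j)]) = wpow [0, 1] d @ [1]"
      by (simp add: Zd wpow_def)
    moreover have "concat (map ?g [Z j..<Z (Suc j)]) = map (snth (mechanical ?b)) [s (Z j)..<s (Z (Suc j))]"
      using map_snth_mechanical_one(1)[OF b] Zd unfolding s_def
      by (intro concat_consecutive) (auto simp: strict_mono_mono)
    ultimately show "(subst0 k \<circ> (\<lambda>j. replicate (Z (Suc j) - Z j) 0 @ [1])) j
      = map (snth (mechanical ?b)) [s (Z j)..<s (Z (Suc j))]"
      using d[of j] k(1) by (auto simp: subst0_def wpow_singleton d_def)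
  qed
qed

text \<open>Here 1 / (1 - a) = 1 + x, so the zeros of the given word are at j + F j and block number
  \<open>j\<close> has \<open>F (Suc j) - F j\<close> ones. In the image 1 / b = 2 + 2 k - x, so
  piece number \<open>j\<close> has length 2 k + 2 minus that number of ones. Thus blocks and pieces
  correspond one to one, and \<open>k + 1\<close> ones become \<open>k\<close> zeros and a 1, while
  \<open>k\<close> ones become \<open>k + 1\<close> zeros and a 1.\<close>

lemma blocks1_mechanical:
  assumes x: "1 \<le> x"
  defines "k \<equiv> nat \<lfloor>x\<rfloor>" and "F \<equiv> \<lambda>j. nat \<lfloor>real j * x\<rfloor>"
  defines "bs \<equiv> smap (\<lambda>j. 0 # replicate (F (Suc j) - F j) 1) nats"
  shows "block_decomposition (blocks1 k) (mechanical (x / (1 + x))) bs"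
    and "flat (smap (subst1 k) bs) = mechanical (1 / (2 - x + 2 * real k))"
proof -
  have k: "1 \<le> k" "real k \<le> x" "x < real k + 1"
    using x unfolding k_def by (auto simp: le_nat_iff le_floor_iff)
  have F: "real (F j) \<le> real j * x" "real j * x < real (F j) + 1" for j
  proof -
    have "0 \<le> real j * x" using x by simp
    then show "real (F j) \<le> real j * x" "real j * x < real (F j) + 1"
      unfolding F_def by linarith+
  qed
  have d: "F (Suc j) = F j + k \<or> F (Suc j) = F j + Suc k" for j
  proof -
    have "real (Suc j) * x = real j * x + x" by (simp add: algebra_simps)
    then have "real (F (Suc j)) < real (F j + Suc k) + 1" "real (F j + k) < real (F (Suc j)) + 1"
      using F[of j] F[of "Suc j"] k by simp_all
    then show ?thesis by linarith
  qed
  have in_blocks: "0 # replicate (F (Suc j) - F j) 1 \<in> blocks1 k" for j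
    using d[of j] by (auto simp: blocks1_def wpow_singleton)
  show "block_decomposition (blocks1 k) (mechanical (x / (1 + x))) bs"
    unfolding block_decomposition_def
  proof
    show "sset bs \<subseteq> blocks1 k"
      using in_blocks by (auto simp: bs_def stream.set_map)
    let ?a = "x / (1 + x)"
    let ?s = "\<lambda>j. nat \<lfloor>real j / (1 - ?a)\<rfloor>"
    have s: "?s j = j + F j" for j
    proof -
      have "real j / (1 - ?a) = real j * x + of_int (int j)" using x by (simp add: field_simps)
      then have "\<lfloor>real j / (1 - ?a)\<rfloor> = \<lfloor>real j * x\<rfloor> + int j" by (simp only: floor_add_int)
      moreover have "0 \<le> real j * x" using x by simp
      ultimately show ?thesis unfolding F_def by linarith
    qed
    have a: "0 < ?a" "?a < 1" using x by auto
    show "flat bs = mechanical ?a"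
      unfolding bs_def
    proof (rule flat_consecutive[of ?s])
      show "0 # replicate (F (Suc j) - F j) 1 = map (snth (mechanical ?a)) [?s j..<?s (Suc j)]" for j
        unfolding map_snth_mechanical_zero(2)[OF a] unfolding s by simp
    qed (use map_snth_mechanical_zero(1)[OF a] in auto)
  qed
  let ?b = "1 / (2 - x + 2 * real k)"
  have b: "0 < ?b" "?b < 1" using k by auto
  define s where "s j = nat \<lceil>real j / ?b\<rceil>" for j
  have s: "int (s j) = (2 + 2 * int k) * int j - int (F j)" for j
  proof -
    have "real j / ?b = of_int ((2 + 2 * int k) * int j) - real j * x" by (simp add: algebra_simps)
    then have "\<lceil>real j / ?b\<rceil> = (2 + 2 * int k) * int j - \<lfloor>real j * x\<rfloor>"
      by (simp only: ceiling_of_int_diff)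
    moreover have "0 \<le> real j / ?b" using b by simp
    moreover have "0 \<le> real j * x" using x by simp
    ultimately show ?thesis unfolding s_def F_def by linarith
  qed
  show "flat (smap (subst1 k) bs) = mechanical ?b"
    unfolding bs_def stream.map_comp
  proof (rule flat_consecutive)
    show "strict_mono s" "s 0 = 0"
      using map_snth_mechanical_one(1)[OF b] unfolding s_def by auto
    fix j
    have "int (s (Suc j)) = int (s j) + 2 + 2 * int k + int (F j) - int (F (Suc j))"
      unfolding s by (simp add: algebra_simps)
    then have "s (Suc j) - s j - 1 = 2 * k + 1 - (F (Suc j) - F j)"
      using d[of j] by auto
    then have "map (snth (mechanical ?b)) [s j..<s (Suc j)] = replicate (2 * k + 1 - (F (Suc j) - F j)) 0 @ [1]"
      using map_snth_mechanical_one(2)[OF b, of j] unfolding s_def by simp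
    then show "(subst1 k \<circ> (\<lambda>j. 0 # replicate (F (Suc j) - F j) 1)) j = map (snth (mechanical ?b)) [s j..<s (Suc j)]"
      using d[of j] by (auto simp: subst1_def wpow_singleton simp del: replicate.simps)
  qed
qed

theorem theorem3p8:
  fixes x :: real and w :: "bit stream"
  assumes "x > 0" and "x \<notin> \<rat>" and "cutting_sequence x w"
  shows "(\<exists>!bs. block_decomposition (blocks x) (0 ## w) bs) \<and>
         (\<exists>wbar. 0 ## wbar = T x (0 ## w) \<and> sturmian wbar \<and> has_slope wbar (R x))"
proof -
  \<comment> \<open>Chosen so that 1 / b - 1 is the denominator of \<open>R x\<close>, whence b / (1
    - b) = R x. It covers both cases, with \<lfloor>x\<rfloor> = 0 when x < 1 and
    \<lfloor>x\<rfloor> = k otherwise.\<close>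
  define b where "b = 1 / (2 - x + 2 * real_of_int \<lfloor>x\<rfloor>)"
  have w: "0 ## w = mechanical (x / (1 + x))"
    by (rule cutting_sequence_eq_mechanical[OF assms])
  have main: "(\<exists>!bs. block_decomposition (blocks x) (0 ## w) bs) \<and> T x (0 ## w) = mechanical b"
  proof (cases "x < 1")
    case True
    then have "\<lfloor>x\<rfloor> = 0" using assms(1) by (simp add: floor_eq_iff)
    with True show ?thesis
      using replace_blocks_eq[OF blocks0_mechanical(1)[OF assms(1) True] blocks0_decomposition_unique]
        blocks0_mechanical(2)[OF assms(1) True]
      by (simp add: w b_def T_def T0_def blocks_def)
  next
    case False
    then have x: "1 \<le> x" and "real_of_int \<lfloor>x\<rfloor> = real (nat \<lfloor>x\<rfloor>)" by simp_all
    with False show ?thesis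
      using replace_blocks_eq[OF blocks1_mechanical(1)[OF x] blocks1_decomposition_unique]
        blocks1_mechanical(2)[OF x]
      by (simp add: w b_def T_def T1_def blocks_def)
  qed
  have den: "1 - x + 2 * real_of_int \<lfloor>x\<rfloor> > 0"
  proof -
    have "0 \<le> real_of_int \<lfloor>x\<rfloor>" using assms(1) by simp
    then show ?thesis by linarith
  qed
  then have b: "0 < b" "b < 1" by (auto simp: b_def)
  have "b \<notin> \<rat>"
  proof
    assume "b \<in> \<rat>"
    then have "2 + 2 * real_of_int \<lfloor>x\<rfloor> - 1 / b \<in> \<rat>"
      by (intro Rats_diff Rats_add Rats_mult Rats_divide) auto
    then show False using assms(2) by (simp add: b_def)
  qed
  moreover have "b / (1 - b) = R x"
    using den by (simp add: b_def R_def field_simps)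
  moreover have "0 ## stl (mechanical b) = mechanical b"
    using mechanical_0[OF b] by (metis snth.simps(1) stream.collapse)
  ultimately show ?thesis
    using main sturmian_mechanical[OF b] has_slope_mechanical[OF b] by metis
qed

end
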